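(* Let $m$ be Lebesgue measure on $\mathbb{R}^d$ and let $u\in L^2_{\mathrm{loc}}(\mathbb{R}^d)$ be a real function whose first-order partial derivatives in the sense of distributions all belong to $L^2(\mathbb{R}^d)$. Then the image (push-forward) under $u$ of the measure $|\operatorname{grad} u|^2\, m$ is absolutely continuous with respect to Lebesgue measure on $\mathbb{R}$.
   Context: Here $\operatorname{grad} u$ is the distributional gradient, $|\operatorname{grad} u|^2$ is the sum of the squares of the partial derivatives, and $|\operatorname{grad} u|^2\,m$ is the finite measure with density $|\operatorname{grad} u|^2$ with respect to $m$. The image measure does not depend on the chosen Borel representative of $u$. *)

theory Defs
  imports "HOL-Analysis.Analysis"
begin

text \<open>Used only where \<open>f\<close> is differentiable; elsewhere the value is unspecified.\<close>

definition partial_deriv :: "'n::finite \<Rightarrow> (real ^ 'n \<Rightarrow> real) \<Rightarrow> real ^ 'n \<Rightarrow> real" where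
  "partial_deriv i f x = frechet_derivative f (at x) (axis i 1)"

primrec C_k :: "nat \<Rightarrow> (real ^ 'n::finite \<Rightarrow> real) \<Rightarrow> bool" where
  "C_k 0 f \<longleftrightarrow> continuous_on UNIV f"
| "C_k (Suc k) f \<longleftrightarrow> f differentiable_on UNIV \<and> (\<forall>i. C_k k (partial_deriv i f))"

definition test_function :: "(real ^ 'n::finite \<Rightarrow> real) \<Rightarrow> bool" where
  "test_function \<phi> \<longleftrightarrow> (\<forall>k. C_k k \<phi>) \<and> compact (closure {x. \<phi> x \<noteq> 0})"

text \<open>The square-integrable spaces consist of Borel functions, not of classes modulo null sets:
  a member is a Borel representative of its class.\<close>

definition L2 :: "(real ^ 'n::finite \<Rightarrow> real) set" where
  "L2 = {f. f \<in> borel_measurable borel \<and> integrable lborel (\<lambda>x. (f x)\<^sup>2)}"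

definition L2_loc :: "(real ^ 'n::finite \<Rightarrow> real) set" where
  "L2_loc = {f. f \<in> borel_measurable borel \<and>
     (\<forall>K. compact K \<longrightarrow> set_integrable lborel K (\<lambda>x. (f x)\<^sup>2))}"

text \<open>The distribution given by a locally integrable function, and the partial derivative of a
  distribution. Distributions are only ever evaluated at test functions. The integral below is
  meaningful for locally integrable \<open>f\<close>, in particular for members of \<open>L2_loc\<close> and \<open>L2\<close>.\<close>

definition distribution_of ::
    "(real ^ 'n::finite \<Rightarrow> real) \<Rightarrow> (real ^ 'n \<Rightarrow> real) \<Rightarrow> real" where
  "distribution_of f \<phi> = (LINT x|lborel. f x * \<phi> x)"

definition distribution_partial ::
    "'n::finite \<Rightarrow> ((real ^ 'n \<Rightarrow> real) \<Rightarrow> real) \<Rightarrow> (real ^ 'n \<Rightarrow> real) \<Rightarrow> real" where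
  "distribution_partial i T \<phi> = - T (partial_deriv i \<phi>)"

definition has_distributional_partial ::
    "(real ^ 'n::finite \<Rightarrow> real) \<Rightarrow> 'n \<Rightarrow> (real ^ 'n \<Rightarrow> real) \<Rightarrow> bool" where
  "has_distributional_partial u i g \<longleftrightarrow>
     (\<forall>\<phi>. test_function \<phi> \<longrightarrow>
        distribution_partial i (distribution_of u) \<phi> = distribution_of g \<phi>)"

end

theory Submission imports Defs begin

text \<open>
  It suffices to show that \<open>g = \<partial>\<^sub>i u\<close> vanishes almost everywhere on \<open>{u \<in> K}\<close> for every compact null set \<open>K\<close>
  and every \<open>i\<close>, because the image measure is finite and hence inner regular. Testing the definition of
  the weak derivative with translates of bumps that approximate indicators of boxes gives
  \<open>u (x + s e\<^sub>i) - u x = \<integral>\<^sub>0\<^sup>s g (x + r e\<^sub>i) dr\<close> for almost every \<open>x\<close>, so that along almost every line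
  \<open>u\<close> coincides almost everywhere with an absolutely continuous function \<open>V\<close> with density \<open>G\<close>.
  For continuous \<open>f\<close> with antiderivative \<open>F\<close> the chain rule \<open>F (V b) - F (V a) = \<integral>\<^sub>a\<^sup>b f (V r) G r dr\<close> holds;
  letting \<open>f\<close> decrease to the indicator of \<open>K\<close>, the left side tends to \<open>0\<close>, hence \<open>G = 0\<close>
  almost everywhere on \<open>{V \<in> K}\<close>. Fubini's theorem carries this back to \<open>\<real>\<^sup>d\<close>.
\<close>

section \<open>Smooth bumps on boxes\<close>

text \<open>The classical flat function exp(-1/t), extended by 0 to t \<le> 0, is
  \<open>flat 1\<close>. The polynomial factor in 1/t makes the family closed under differentiation,
  so that smoothness becomes an induction.\<close>

definition flat :: "real poly \<Rightarrow> real \<Rightarrow> real" where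
  "flat p t = (if 0 < t then poly p (1 / t) * exp (- (1 / t)) else 0)"

lemma flat_smult: "flat (smult c p) t = c * flat p t"
  by (simp add: flat_def)

lemma poly_mult_exp_minus_at_top: "((\<lambda>x::real. poly p x * exp (- x)) \<longlongrightarrow> 0) at_top"
proof -
  have "((\<lambda>x::real. \<Sum>i\<le>degree p. coeff p i * (x ^ i / exp x)) \<longlongrightarrow> (\<Sum>i\<le>degree p. coeff p i * 0)) at_top"
    by (intro tendsto_intros tendsto_power_div_exp_0)
  then show ?thesis
    by (simp add: poly_altdef exp_minus sum_distrib_right divide_inverse mult.assoc)
qed

text \<open>For t > 0 the chain rule applied to p(1/t) exp(-1/t) produces the factor 1/t^2, which is
  multiplication of the polynomial by \<open>[:0, 0, 1:]\<close>. At 0 the exponential beats every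
  power of 1/t, so both one-sided difference quotients tend to 0.\<close>

lemma has_real_derivative_flat:
  "(flat p has_real_derivative flat ([:0, 0, 1:] * (p - pderiv p)) t) (at t)"
proof -
  consider "t < 0" | "t = 0" | "0 < t" by linarith
  then show ?thesis
  proof cases
    case 1
    have "((\<lambda>_. 0) has_real_derivative 0) (at t)" by simp
    then have "(flat p has_real_derivative 0) (at t)"
      by (rule has_field_derivative_transform_within_open[where S = "{..<0}"])
         (use 1 in \<open>auto simp: flat_def\<close>)
    then show ?thesis using 1 by (simp add: flat_def)
  next
    case 2
    \<comment> \<open>Dividing \<open>flat p h\<close> by \<open>h\<close> multiplies the polynomial
      in 1/h by its variable; hence \<open>pCons 0 p\<close>.\<close>
    have "((\<lambda>x. poly (pCons 0 p) (1 / x) * exp (- (1 / x))) \<longlongrightarrow> 0) (at_right (0::real))"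
      using filterlim_compose[OF poly_mult_exp_minus_at_top[of "pCons 0 p"] filterlim_inverse_at_top_right]
      by (simp add: inverse_eq_divide)
    then have "((\<lambda>h. flat p h / h) \<longlongrightarrow> 0) (at_right 0)"
      by (rule Lim_transform_eventually)
         (auto simp: flat_def divide_simps intro!: eventually_at_rightI[of 0 1])
    moreover have "((\<lambda>h. flat p h / h) \<longlongrightarrow> 0) (at_left 0)"
      by (rule tendsto_eventually) (auto simp: flat_def intro!: eventually_at_leftI[of "-1" 0])
    ultimately have "((\<lambda>h. flat p h / h) \<longlongrightarrow> 0) (at 0)"
      by (simp add: filterlim_split_at)
    then show ?thesis using 2 by (simp add: DERIV_def flat_def)
  next
    case 3
    have inv: "((\<lambda>t. 1 / t) has_real_derivative - (1 / t\<^sup>2)) (at t)"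
      using 3 by (auto intro!: derivative_eq_intros simp: power2_eq_square)
    have "((\<lambda>t. poly p (1 / t) * exp (- (1 / t))) has_real_derivative
        poly (pderiv p) (1 / t) * - (1 / t\<^sup>2) * exp (- (1 / t))
          + exp (- (1 / t)) * - (- (1 / t\<^sup>2)) * poly p (1 / t)) (at t)"
      by (intro DERIV_mult DERIV_chain2[OF poly_DERIV] DERIV_chain2[OF DERIV_exp] DERIV_minus inv)
    also have "poly (pderiv p) (1 / t) * - (1 / t\<^sup>2) * exp (- (1 / t))
          + exp (- (1 / t)) * - (- (1 / t\<^sup>2)) * poly p (1 / t) = flat ([:0, 0, 1:] * (p - pderiv p)) t"
      using 3 by (simp add: flat_def field_simps power2_eq_square)
    finally have "((\<lambda>t. poly p (1 / t) * exp (- (1 / t))) has_real_derivative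
        flat ([:0, 0, 1:] * (p - pderiv p)) t) (at t)" .
    then show ?thesis
      by (rule has_field_derivative_transform_within_open[where S = "{0<..}"])
         (use 3 in \<open>auto simp: flat_def\<close>)
  qed
qed

section \<open>Closure properties of the classes \<open>C_k\<close>\<close>

lemma partial_derivI: "(f has_derivative D) (at x) \<Longrightarrow> partial_deriv i f x = D (axis i 1)"
  unfolding partial_deriv_def by (metis frechet_derivative_at)

lemma C_k_Suc_imp_C_k: "C_k (Suc k) f \<Longrightarrow> C_k k f"
proof (induction k arbitrary: f)
  case 0
  then show ?case by (simp add: differentiable_imp_continuous_on)
next
  case (Suc k)
  then show ?case using C_k.simps(2) by blast
qed

lemma C_k_const: "C_k k (\<lambda>x::real^'n. c)"
proof (induction k arbitrary: c)
  case (Suc k)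
  have "partial_deriv i (\<lambda>x::real^'n. c) = (\<lambda>x. 0)" for i
    by (rule ext) (rule partial_derivI, rule has_derivative_const)
  then show ?case using Suc by simp
qed simp

lemma C_k_add: "C_k k f \<Longrightarrow> C_k k g \<Longrightarrow> C_k k (\<lambda>x. f x + g x)"
proof (induction k arbitrary: f g)
  case (Suc k)
  have "(f has_derivative frechet_derivative f (at x)) (at x)"
       "(g has_derivative frechet_derivative g (at x)) (at x)" for x
    using Suc.prems by (simp_all add: differentiable_on_def flip: frechet_derivative_works)
  from has_derivative_add[OF this]
  have "partial_deriv i (\<lambda>x. f x + g x) = (\<lambda>x. partial_deriv i f x + partial_deriv i g x)" for i
    by (intro ext, subst partial_derivI) (auto simp: partial_deriv_def)
  then show ?case using Suc by simp
qed (simp add: continuous_on_add)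

lemma C_k_mult: "C_k k f \<Longrightarrow> C_k k g \<Longrightarrow> C_k k (\<lambda>x. f x * g x)"
proof (induction k arbitrary: f g)
  case (Suc k)
  have "(f has_derivative frechet_derivative f (at x)) (at x)"
       "(g has_derivative frechet_derivative g (at x)) (at x)" for x
    using Suc.prems by (simp_all add: differentiable_on_def flip: frechet_derivative_works)
  from has_derivative_mult[OF this]
  have "partial_deriv i (\<lambda>x. f x * g x) = (\<lambda>x. f x * partial_deriv i g x + partial_deriv i f x * g x)" for i
    by (intro ext, subst partial_derivI) (auto simp: partial_deriv_def)
  \<comment> \<open>The product rule also leaves undifferentiated factors, which have to be of class
    \<open>C_k k\<close> for the induction hypothesis.\<close>
  moreover have "C_k k f" "C_k k g" using Suc.prems C_k_Suc_imp_C_k by blast+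
  ultimately show ?case using Suc by (simp add: C_k_add)
qed (simp add: continuous_on_mult)

lemma C_k_prod:
  assumes "\<And>j. j \<in> J \<Longrightarrow> C_k k (f j)"
  shows "C_k k (\<lambda>x. \<Prod>j\<in>J. f j x)"
  using assms by (induction J rule: infinite_finite_induct) (auto intro: C_k_const C_k_mult)

text \<open>The induction varies \<open>p\<close>, because each partial derivative is again of this
  form. The inner derivative, which is 0 for i \<noteq> j, is absorbed into the polynomial by
  \<open>smult\<close>.\<close>

lemma C_k_flat: "C_k k (\<lambda>x::real^'n. flat p (\<alpha> * x $ j + \<beta>))"
proof (induction k arbitrary: p)
  case 0
  have "continuous_on UNIV (flat p)"
    by (rule DERIV_continuous_on[where D = "flat ([:0, 0, 1:] * (p - pderiv p))"])
       (rule has_field_derivative_at_within[OF has_real_derivative_flat])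
  then show ?case
    using continuous_on_compose2[of UNIV "flat p" UNIV "\<lambda>x::real^'n. \<alpha> * x $ j + \<beta>"]
    by (simp add: continuous_on_add continuous_on_mult_left continuous_on_component)
next
  case (Suc k)
  let ?p' = "[:0, 0, 1:] * (p - pderiv p)"
  have D: "((\<lambda>x::real^'n. flat p (\<alpha> * x $ j + \<beta>)) has_derivative
      (\<lambda>h. flat ?p' (\<alpha> * x $ j + \<beta>) * (\<alpha> * h $ j))) (at x)" for x
  proof -
    have "((\<lambda>x::real^'n. \<alpha> * x $ j + \<beta>) has_derivative (\<lambda>h. \<alpha> * h $ j)) (at x)"
      by (auto intro!: derivative_eq_intros bounded_linear_imp_has_derivative bounded_linear_vec_nth)
    from has_derivative_compose[OF this has_real_derivative_flat[unfolded has_field_derivative_def]]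
    show ?thesis .
  qed
  have "partial_deriv i (\<lambda>x::real^'n. flat p (\<alpha> * x $ j + \<beta>)) =
      (\<lambda>x. flat (smult (\<alpha> * axis i 1 $ j) ?p') (\<alpha> * x $ j + \<beta>))" for i
    by (rule ext) (simp only: partial_derivI[OF D] flat_smult mult.commute)
  moreover have "(\<lambda>x::real^'n. flat p (\<alpha> * x $ j + \<beta>)) differentiable_on UNIV"
    using D by (auto simp: differentiable_on_def differentiable_def)
  ultimately show ?case using Suc by simp
qed

text \<open>The parameter \<open>m\<close> is a steepness: for t > 0 the factor
  \<open>flat 1 (m * t)\<close> is exp(-1/(m t)), which tends to 1 as \<open>m\<close> grows. The
  bumps thus approximate the indicator of the open box from inside, with supports in one fixed
  closed box.\<close>

definition bump :: "real \<Rightarrow> real ^ 'n \<Rightarrow> real ^ 'n \<Rightarrow> real ^ 'n \<Rightarrow> real" where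
  "bump m a b x = (\<Prod>j\<in>UNIV. flat 1 (m * (x $ j - a $ j)) * flat 1 (m * (b $ j - x $ j)))"

lemma C_k_bump: "C_k k (bump m a b)"
proof -
  have "C_k k (\<lambda>x. \<Prod>j\<in>UNIV. flat 1 (m * x $ j + (- m * a $ j)) * flat 1 (- m * x $ j + m * b $ j))"
    by (intro C_k_prod C_k_mult C_k_flat)
  then show ?thesis by (simp add: bump_def[abs_def] algebra_simps)
qed

lemma bump_nonneg: "0 \<le> bump m a b x"
  by (auto simp: bump_def flat_def intro!: prod_nonneg)

lemma bump_le_1: "bump m a b x \<le> 1"
  unfolding bump_def by (intro prod_le_1) (auto simp: flat_def mult_le_one simp flip: exp_add)

lemma bump_eq_0:
  assumes "0 < m" "x \<notin> box a b"
  shows "bump m a b x = 0"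
proof -
  obtain j where "x $ j \<le> a $ j \<or> b $ j \<le> x $ j"
    using assms(2) by (auto simp: mem_box_cart not_less)
  then have "flat 1 (m * (x $ j - a $ j)) * flat 1 (m * (b $ j - x $ j)) = 0"
    using \<open>0 < m\<close> by (auto simp: flat_def zero_less_mult_iff)
  then show ?thesis by (auto simp: bump_def)
qed

lemma bump_translate: "bump m (a + c) (b + c) x = bump m a b (x - c)"
  by (simp add: bump_def algebra_simps)

lemma tendsto_bump: "(\<lambda>m. bump (real (Suc m)) a b x) \<longlonglongrightarrow> indicator (box a b) x"
proof (cases "x \<in> box a b")
  case True
  have flat: "(\<lambda>m. flat 1 (real (Suc m) * t)) \<longlonglongrightarrow> 1" if "0 < t" for t :: real
  proof -
    have "(\<lambda>m. exp (- (inverse (real (Suc m)) * (1 / t)))) \<longlonglongrightarrow> exp (- (0 * (1 / t)))"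
      by (intro tendsto_intros LIMSEQ_inverse_real_of_nat)
    then show ?thesis using that by (simp add: flat_def divide_inverse mult.commute)
  qed
  have "(\<lambda>m. bump (real (Suc m)) a b x) \<longlonglongrightarrow> (\<Prod>j::'a\<in>UNIV. 1 * 1)"
    unfolding bump_def by (intro tendsto_prod tendsto_mult flat) (use True in \<open>auto simp: mem_box_cart\<close>)
  then show ?thesis using True by simp
next
  case False
  then show ?thesis by (simp add: bump_eq_0)
qed

lemma test_function_bump:
  assumes "0 < m"
  shows "test_function (bump m a b)"
proof -
  have "closure {x. bump m a b x \<noteq> 0} \<subseteq> cbox a b"
    using bump_eq_0[OF assms] box_subset_cbox[of a b] by (intro closure_minimal) auto
  then show ?thesis
    by (auto simp: test_function_def C_k_bump compact_eq_bounded_closed intro: bounded_subset[OF bounded_cbox])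
qed

section \<open>Indefinite integrals on the line\<close>

text \<open>The positive and the negative part of \<open>w\<close> define measures that agree on
  boxes. Boxes form an intersection-stable generator of the Borel sets, so the measures coincide,
  and densities are unique almost everywhere.\<close>

lemma box_integrals_zero_imp_AE_zero:
  fixes w :: "'a::euclidean_space \<Rightarrow> real"
  assumes w: "integrable lborel w"
    and zero: "\<And>a b. (\<integral>x. indicator (box a b) x * w x \<partial>lborel) = 0"
  shows "AE x in lborel. w x = 0"
proof -
  \<comment> \<open>\<open>ennreal\<close> sends negative reals to 0, so these densities are the
    positive and the negative part of \<open>w\<close>.\<close>
  let ?P = "density lborel (\<lambda>x. ennreal (w x))" and ?N = "density lborel (\<lambda>x. ennreal (- w x))"
  have [measurable]: "w \<in> borel_measurable borel" using w by auto
  have emeasure_density_eq: "emeasure (density lborel (\<lambda>x. ennreal (f x))) X =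
      ennreal (\<integral>x. indicator X x * max 0 (f x) \<partial>lborel)"
    if [measurable]: "X \<in> sets borel" and f: "integrable lborel f" for f :: "'a \<Rightarrow> real" and X
  proof -
    have [measurable]: "f \<in> borel_measurable borel" using f by auto
    have "emeasure (density lborel (\<lambda>x. ennreal (f x))) X =
        (\<integral>\<^sup>+x. ennreal (indicator X x * max 0 (f x)) \<partial>lborel)"
      by (simp add: emeasure_density) (intro nn_integral_cong, auto simp: indicator_def max_def ennreal_neg)
    also have "\<dots> = ennreal (\<integral>x. indicator X x * max 0 (f x) \<partial>lborel)"
      by (intro nn_integral_eq_integral Bochner_Integration.integrable_bound[OF f])
         (auto simp: indicator_def)
    finally show ?thesis .
  qed
  have "?P = ?N"
  proof (rule measure_eqI_generator_eq)
    let ?E = "range (\<lambda>(a, b). box a b :: 'a set)"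
    show "Int_stable ?E" by (auto simp: Int_stable_def box_Int_box)
    show "?E \<subseteq> Pow UNIV" "sets ?P = sigma_sets UNIV ?E" "sets ?N = sigma_sets UNIV ?E"
      by (simp_all add: borel_eq_box)
    let ?A = "\<lambda>n::nat. box (- (real n *\<^sub>R One)) (real n *\<^sub>R One) :: 'a set"
    show "range ?A \<subseteq> ?E" "(\<Union>i. ?A i) = UNIV" using UN_box_eq_UNIV by auto
    show "emeasure ?P (?A i) \<noteq> \<infinity>" for i by (simp add: emeasure_density_eq w)
    fix X assume "X \<in> ?E"
    then obtain a b where X: "X = box a b" by auto
    have int: "integrable lborel (\<lambda>x. indicator X x * max 0 (w x))"
         "integrable lborel (\<lambda>x. indicator X x * max 0 (- w x))"
      by (auto intro!: Bochner_Integration.integrable_bound[OF w] AE_I2 simp: X indicator_def)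
    have "(\<integral>x. indicator X x * max 0 (w x) \<partial>lborel) - (\<integral>x. indicator X x * max 0 (- w x) \<partial>lborel)
        = (\<integral>x. indicator X x * w x \<partial>lborel)"
      unfolding Bochner_Integration.integral_diff[OF int, symmetric]
      by (intro Bochner_Integration.integral_cong) (auto simp: max_def algebra_simps)
    then show "emeasure ?P X = emeasure ?N X"
      using zero[of a b] w by (simp add: X emeasure_density_eq)
  qed
  then have "AE x in lborel. ennreal (w x) = ennreal (- w x)"
    by (subst (asm) sigma_finite_measure.density_unique_iff[OF lborel.sigma_finite_measure_axioms]) auto
  then show ?thesis
  proof eventually_elim
    case (elim x)
    then show ?case by (cases "0 \<le> w x") (auto simp: ennreal_neg dest: sym)
  qed
qed

text \<open>\<open>V\<close> is an absolutely continuous function with density \<open>G\<close>, and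
  \<open>c\<close> is its limit at minus infinity. Integrating from minus infinity defines
  \<open>V\<close> on the whole line, and integrability of \<open>G\<close> keeps it
  bounded.\<close>

locale indefinite_integral =
  fixes G :: "real \<Rightarrow> real" and V :: "real \<Rightarrow> real" and c :: real
  assumes integrable: "integrable lborel G"
    and V_eq: "\<And>t. V t = c + (\<integral>r. indicator {..t} r * G r \<partial>lborel)"
begin

lemma measurable_G [measurable]: "G \<in> borel_measurable borel"
  using integrable by auto

lemma integrable_mult:
  assumes [measurable]: "h \<in> borel_measurable borel" and h: "\<And>r. \<bar>h r\<bar> \<le> M"
  shows "integrable lborel (\<lambda>r. h r * G r)"
proof (rule Bochner_Integration.integrable_bound)
  show "integrable lborel (\<lambda>r. M * G r)" using integrable by simp
  show "AE r in lborel. norm (h r * G r) \<le> norm (M * G r)"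
    using order_trans[OF h abs_ge_self] by (intro AE_I2) (simp add: abs_mult mult_right_mono)
qed measurable

lemma integrable_indicator: "A \<in> sets borel \<Longrightarrow> integrable lborel (\<lambda>r. indicator A r * G r)"
  by (rule integrable_mult[where M = 1]) (auto simp: indicator_def)

lemma V_diff: "s \<le> t \<Longrightarrow> V t - V s = (\<integral>r. indicator {s<..t} r * G r \<partial>lborel)"
proof -
  assume "s \<le> t"
  have "V t - V s = (\<integral>r. indicator {..t} r * G r - indicator {..s} r * G r \<partial>lborel)"
    by (simp add: V_eq integrable_indicator)
  also have "\<dots> = (\<integral>r. indicator {s<..t} r * G r \<partial>lborel)"
    using \<open>s \<le> t\<close> by (intro Bochner_Integration.integral_cong) (auto simp: indicator_def)
  finally show ?thesis .
qed

text \<open>Dominated convergence with majorant \<bar>G\<bar>: for r \<noteq> t the indicators at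
  \<open>r\<close> are eventually constant, and the single point \<open>t\<close> is a null
  set.\<close>

lemma isCont_V: "isCont V t"
  unfolding continuous_at_sequentially comp_def
proof safe
  fix x assume x: "x \<longlonglongrightarrow> t"
  have "(\<lambda>n. \<integral>r. indicator {..x n} r * G r \<partial>lborel) \<longlonglongrightarrow> (\<integral>r. indicator {..t} r * G r \<partial>lborel)"
  proof (rule integral_dominated_convergence)
    show "integrable lborel (\<lambda>r. \<bar>G r\<bar>)" using integrable by simp
    show "AE r in lborel. (\<lambda>n. indicator {..x n} r * G r) \<longlonglongrightarrow> indicator {..t} r * G r"
    proof (rule eventually_mono[OF AE_lborel_singleton[of t]])
      fix r assume "r \<noteq> t"
      then have "\<forall>\<^sub>F n in sequentially. r \<le> x n \<longleftrightarrow> r \<le> t"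
        using order_tendstoD[OF x, of r] by (cases "r < t") (auto elim!: eventually_mono)
      then have "\<forall>\<^sub>F n in sequentially. indicator {..x n} r * G r = indicator {..t} r * G r"
        by eventually_elim (simp add: indicator_def)
      then show "(\<lambda>n. indicator {..x n} r * G r) \<longlonglongrightarrow> indicator {..t} r * G r"
        by (rule tendsto_eventually)
    qed
  qed (auto simp: indicator_def)
  then show "(\<lambda>n. V (x n)) \<longlonglongrightarrow> V t" unfolding V_eq by (intro tendsto_intros)
qed

lemma continuous_on_V: "continuous_on A V"
  by (simp add: continuous_at_imp_continuous_on isCont_V)

lemma measurable_V [measurable]: "V \<in> borel_measurable borel"
  by (rule borel_measurable_continuous_onI[OF continuous_on_V])

lemma abs_V_le: "\<bar>V t\<bar> \<le> \<bar>c\<bar> + (\<integral>r. \<bar>G r\<bar> \<partial>lborel)"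
proof -
  have "\<bar>\<integral>r. indicator {..t} r * G r \<partial>lborel\<bar> \<le> (\<integral>r. \<bar>indicator {..t} r * G r\<bar> \<partial>lborel)"
    by (rule integral_abs_bound)
  also have "\<dots> \<le> (\<integral>r. \<bar>G r\<bar> \<partial>lborel)"
    by (intro integral_mono integrable_abs integrable_indicator integrable) (auto simp: indicator_def)
  finally show ?thesis unfolding V_eq by linarith
qed

text \<open>Only the values of \<open>F\<close> on an interval containing the range of
  \<open>V\<close> matter, so \<open>F\<close> is differentiated within \<open>{- B..B}\<close>.
  This fits an \<open>F\<close> obtained by integrating from \<open>- B\<close>.\<close>

lemma chain_rule:
  assumes cont: "continuous_on UNIV f" and bounded: "\<And>y. \<bar>f y\<bar> \<le> M"
    and range: "\<And>t. V t \<in> {- B..B}"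
    and F: "\<And>y. y \<in> {- B..B} \<Longrightarrow> (F has_real_derivative f y) (at y within {- B..B})"
    and "a \<le> b"
  shows "F (V b) - F (V a) = (\<integral>r. indicator {a<..b} r * (f (V r) * G r) \<partial>lborel)"
proof -
  have [measurable]: "f \<in> borel_measurable borel"
    by (rule borel_measurable_continuous_onI[OF cont])
  have int_f: "integrable lborel (\<lambda>r. indicator {s<..t} r * (f (V r) * G r))" for s t
    using integrable_mult[of "\<lambda>r. indicator {s<..t} r * f (V r)" M] order_trans[OF abs_ge_zero bounded]
    by (auto simp: indicator_def mult.assoc bounded split: if_splits)
  have int_abs: "integrable lborel (\<lambda>r. indicator {s<..t} r * \<bar>G r\<bar>)" for s t
    using integrable_norm[OF integrable_indicator[of "{s<..t}"]] by (simp add: abs_mult)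
  \<comment> \<open>\<open>V\<close> need not be monotone, so the endpoints come in either order;
    hence \<open>min\<close> and \<open>max\<close>.\<close>
  have mean_value: "\<exists>z. min p q \<le> z \<and> z \<le> max p q \<and> F q - F p = f z * (q - p)"
    if pq: "p \<in> {- B..B}" "q \<in> {- B..B}" for p q
  proof -
    have *: "\<exists>z\<in>{p..q}. F q - F p = f z * (q - p)"
      if "p \<le> q" "p \<in> {- B..B}" "q \<in> {- B..B}" for p q
    proof (rule mvt_very_simple[OF \<open>p \<le> q\<close>])
      fix y assume "p \<le> y" "y \<le> q"
      then show "(F has_derivative (*) (f y)) (at y within {p..q})"
        using F[of y] that by (auto simp: has_field_derivative_def intro: has_derivative_subset)
    qed
    show ?thesis
    proof (cases "p \<le> q")
      case True
      then show ?thesis using *[of p q] pq by auto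
    next
      case False
      then obtain z where "z \<in> {q..p}" "F p - F q = f z * (p - q)" using *[of q p] pq by auto
      then show ?thesis using False by (intro exI[of _ z]) (auto simp: algebra_simps)
    qed
  qed
  text \<open>The error of the chain rule is additive in the interval and, by the mean value theorem and
    continuity of \<open>f \<circ> V\<close>, at most \<open>e\<close> times the integral of \<open>\<bar>G\<bar>\<close> over short intervals.\<close>
  define E where "E s t = F (V t) - F (V s) - (\<integral>r. indicator {s<..t} r * (f (V r) * G r) \<partial>lborel)" for s t
  have E_le: "\<bar>E a b\<bar> \<le> e * (\<integral>r. indicator {a<..b} r * \<bar>G r\<bar> \<partial>lborel)" if "0 < e" for e
    using \<open>a \<le> b\<close>
  proof (induction rule: Bolzano)
    case (trans s t u)
    have ind: "indicator {s<..u} r = (indicator {s<..t} r + indicator {t<..u} r :: real)" for r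
      using trans by (auto simp: indicator_def)
    have "E s u = E s t + E t u"
      unfolding E_def ind distrib_right Bochner_Integration.integral_add[OF int_f int_f] by simp
    moreover have "(\<integral>r. indicator {s<..u} r * \<bar>G r\<bar> \<partial>lborel)
        = (\<integral>r. indicator {s<..t} r * \<bar>G r\<bar> \<partial>lborel) + (\<integral>r. indicator {t<..u} r * \<bar>G r\<bar> \<partial>lborel)"
      unfolding ind distrib_right Bochner_Integration.integral_add[OF int_abs int_abs] by simp
    ultimately show ?case using trans by (simp add: distrib_left)
  next
    case (local x)
    have "isCont f (V x)" using cont by (simp add: continuous_on_eq_continuous_at)
    \<comment> \<open>Half of \<open>e\<close>, because \<open>f z\<close> and
      \<open>f (V r)\<close> will both be compared with \<open>f (V x)\<close>.\<close>
    then obtain h where "0 < h" and h: "\<And>y. \<bar>y - V x\<bar> < h \<Longrightarrow> \<bar>f y - f (V x)\<bar> < e / 2"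
      using \<open>0 < e\<close> unfolding continuous_at_eps_delta dist_real_def by (metis half_gt_zero)
    then obtain d where "0 < d" and d: "\<And>r. \<bar>r - x\<bar> < d \<Longrightarrow> \<bar>V r - V x\<bar> < h"
      using isCont_V[of x] unfolding continuous_at_eps_delta dist_real_def by metis
    show ?case
    proof (intro exI[of _ d] conjI allI impI \<open>0 < d\<close>)
      fix s t assume st: "s \<le> x \<and> x \<le> t \<and> t - s < d"
      obtain z where z: "min (V s) (V t) \<le> z" "z \<le> max (V s) (V t)"
        and Fz: "F (V t) - F (V s) = f z * (V t - V s)"
        using mean_value[OF range range] by blast
      have "\<bar>V s - V x\<bar> < h" "\<bar>V t - V x\<bar> < h" using st by (auto intro!: d)
      then have "\<bar>z - V x\<bar> < h" using z by linarith
      have close: "\<bar>f z - f (V r)\<bar> \<le> e" if "r \<in> {s<..t}" for r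
      proof -
        have "\<bar>r - x\<bar> < d" using that st by auto
        then show ?thesis using h[OF \<open>\<bar>z - V x\<bar> < h\<close>] h[OF d[of r]] by linarith
      qed
      \<comment> \<open>By \<open>V_diff\<close> the increment of \<open>V\<close> is itself an
        integral of \<open>G\<close>, so the error is the single integral of (f z - f (V r)) G r
        over the short interval.\<close>
      have "E s t = (\<integral>r. f z * (indicator {s<..t} r * G r) - indicator {s<..t} r * (f (V r) * G r) \<partial>lborel)"
        using st V_diff[of s t] int_f integrable_indicator[of "{s<..t}"] by (simp add: E_def Fz)
      also have "\<bar>\<dots>\<bar> \<le> (\<integral>r. e * (indicator {s<..t} r * \<bar>G r\<bar>) \<partial>lborel)"
      proof (rule order_trans[OF integral_abs_bound integral_mono])
        fix r
        show "\<bar>f z * (indicator {s<..t} r * G r) - indicator {s<..t} r * (f (V r) * G r)\<bar>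
            \<le> e * (indicator {s<..t} r * \<bar>G r\<bar>)"
          using mult_right_mono[OF close[of r] abs_ge_zero[of "G r"]]
          by (auto simp: indicator_def abs_mult[symmetric] left_diff_distrib)
      qed (use int_f int_abs integrable_indicator[of "{s<..t}"] in auto)
      finally show "\<bar>E s t\<bar> \<le> e * (\<integral>r. indicator {s<..t} r * \<bar>G r\<bar> \<partial>lborel)" by simp
    qed
  qed
  have "((\<lambda>e. e * (\<integral>r. indicator {a<..b} r * \<bar>G r\<bar> \<partial>lborel)) \<longlongrightarrow> 0 * (\<integral>r. indicator {a<..b} r * \<bar>G r\<bar> \<partial>lborel))
      (at_right 0)"
    by (intro tendsto_intros)
  then have "\<bar>E a b\<bar> \<le> 0"
    by (intro tendsto_lowerbound[where f = "\<lambda>e. e * (\<integral>r. indicator {a<..b} r * \<bar>G r\<bar> \<partial>lborel)" and F = "at_right 0"])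
       (auto simp: eventually_at_right_less intro!: eventually_at_rightI[of 0 1] E_le)
  then show ?thesis by (simp add: E_def)
qed

text \<open>The chain rule is applied to functions \<open>f n\<close> tending to the indicator of
  \<open>K\<close>. The increments of their antiderivatives are bounded by integrals that tend to
  the measure of \<open>K\<close> in \<open>{- B..B}\<close>, which is 0. So the indicator of {V
  \<in> K} times \<open>G\<close> integrates to 0 over every interval.\<close>

lemma AE_eq_0_on_compact_null:
  assumes "compact K" and null: "emeasure lborel K = 0"
  shows "AE t in lborel. V t \<in> K \<longrightarrow> G t = 0"
\<comment> \<open>The distance \<open>infdist\<close> to the empty set is 0 by convention, which
  would make \<open>f n\<close> constantly 1; the empty case is trivial anyway.\<close>
proof (cases "K = {}")
  case False
  have [measurable]: "K \<in> sets borel" using \<open>compact K\<close> by (rule borel_compact)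
  define B where "B = \<bar>c\<bar> + (\<integral>r. \<bar>G r\<bar> \<partial>lborel)"
  \<comment> \<open>A continuous function equal to 1 on \<open>K\<close> that falls to 0 at distance
    1/n from \<open>K\<close>; its pointwise limit is the indicator because \<open>K\<close> is
    closed.\<close>
  define f where "f n y = max 0 (1 - real n * infdist y K)" for n y
  define F where "F n y = integral {- B..y} (f n)" for n y
  define w where "w t = indicator K (V t) * G t" for t
  have range: "V t \<in> {- B..B}" for t using abs_V_le[of t] by (auto simp: B_def)
  have cont: "continuous_on A (f n)" for n A
    unfolding f_def by (intro continuous_intros)
  have [measurable]: "f n \<in> borel_measurable borel" for n
    by (rule borel_measurable_continuous_onI[OF cont])
  have f_nonneg: "0 \<le> f n y" and f_le_1: "f n y \<le> 1" for n y
    by (auto simp: f_def infdist_nonneg)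
  have f_lim: "(\<lambda>n. f n y) \<longlonglongrightarrow> indicator K y" for y
  proof (cases "y \<in> K")
    case True
    then show ?thesis by (simp add: f_def)
  next
    case outside: False
    then have "0 < infdist y K"
      using False \<open>compact K\<close> by (simp add: infdist_pos_not_in_closed compact_imp_closed)
    have "\<forall>\<^sub>F n in sequentially. f n y = 0"
      using eventually_ge_at_top[of "nat \<lceil>1 / infdist y K\<rceil>"]
    proof eventually_elim
      case (elim n)
      then have "1 / infdist y K \<le> real n" by linarith
      then show ?case using \<open>0 < infdist y K\<close> by (simp add: f_def field_simps)
    qed
    then show ?thesis using outside by (simp add: tendsto_eventually)
  qed
  \<comment> \<open>Since f n \<ge> 0, both values of \<open>F n\<close> lie between 0 and the
    integral of \<open>f n\<close> over all of \<open>{- B..B}\<close>.\<close>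
  have F_bound: "\<bar>F n (V b) - F n (V a)\<bar> \<le> (\<integral>y. indicator {- B..B} y * f n y \<partial>lborel)" for n a b
  proof -
    have int: "f n integrable_on {p..q}" for p q
      by (rule integrable_continuous_interval[OF cont])
    have F_le: "0 \<le> F n (V t) \<and> F n (V t) \<le> integral {- B..B} (f n)" for t
      using range[of t] unfolding F_def
      by (auto intro!: integral_nonneg integral_subset_le int f_nonneg)
    have "(LINT y:{- B..B}|lborel. f n y) = integral {- B..B} (f n)"
      by (rule set_borel_integral_eq_integral[OF borel_integrable_atLeastAtMost'[OF cont]])
    then show ?thesis
      using F_le[of a] F_le[of b] by (simp add: set_lebesgue_integral_def abs_le_iff)
  qed
  have I_lim: "(\<lambda>n. \<integral>y. indicator {- B..B} y * f n y \<partial>lborel) \<longlonglongrightarrow> 0"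
  proof -
    have "(\<lambda>n. \<integral>y. indicator {- B..B} y * f n y \<partial>lborel)
        \<longlonglongrightarrow> (\<integral>y. indicator {- B..B} y * indicator K y \<partial>lborel)"
    proof (rule integral_dominated_convergence)
      show "integrable lborel (indicator {- B..B} :: real \<Rightarrow> real)"
        by (simp add: emeasure_lborel_Icc_eq)
      show "AE y in lborel. (\<lambda>n. indicator {- B..B} y * f n y) \<longlonglongrightarrow> indicator {- B..B} y * indicator K y"
        by (intro AE_I2 tendsto_intros f_lim)
    qed (auto simp: indicator_def f_nonneg f_le_1)
    moreover have "(\<integral>y. indicator {- B..B} y * indicator K y \<partial>lborel) = (0 :: real)"
    proof (rule integral_eq_zero_AE)
      have "AE y in lborel. y \<notin> K" using null by (intro AE_not_in) (auto intro: null_setsI)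
      then show "AE y in lborel. indicator {- B..B} y * indicator K y = (0 :: real)"
        by eventually_elim simp
    qed
    ultimately show ?thesis by simp
  qed
  have w_eq_0: "(\<integral>r. indicator {a<..b} r * w r \<partial>lborel) = 0" if "a \<le> b" for a b
  proof -
    have "(\<lambda>n. \<integral>r. indicator {a<..b} r * (f n (V r) * G r) \<partial>lborel)
        \<longlonglongrightarrow> (\<integral>r. indicator {a<..b} r * w r \<partial>lborel)"
      unfolding w_def
    proof (rule integral_dominated_convergence)
      show "integrable lborel (\<lambda>r. \<bar>G r\<bar>)" using integrable by simp
      show "AE r in lborel. norm (indicator {a<..b} r * (f n (V r) * G r)) \<le> \<bar>G r\<bar>" for n
        using mult_right_mono[OF f_le_1 abs_ge_zero] f_nonneg
        by (intro AE_I2) (auto simp: abs_mult indicator_def)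
    qed (auto intro!: tendsto_intros f_lim AE_I2)
    moreover have "(\<integral>r. indicator {a<..b} r * (f n (V r) * G r) \<partial>lborel) = F n (V b) - F n (V a)" for n
    proof (rule chain_rule[symmetric])
      show "continuous_on UNIV (f n)" by (rule cont)
      show "\<bar>f n y\<bar> \<le> 1" for y using f_nonneg f_le_1 by simp
      show "(F n has_real_derivative f n y) (at y within {- B..B})" if "y \<in> {- B..B}" for y
        unfolding F_def by (rule integral_has_real_derivative[OF cont that])
    qed (fact range that)+
    moreover have "(\<lambda>n. F n (V b) - F n (V a)) \<longlonglongrightarrow> 0"
      by (rule Lim_null_comparison[OF _ I_lim]) (simp add: F_bound)
    ultimately show ?thesis by (simp add: LIMSEQ_unique)
  qed
  have "AE t in lborel. w t = 0"
  proof (rule box_integrals_zero_imp_AE_zero)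
    show "integrable lborel w"
      unfolding w_def by (rule integrable_mult[where M = 1]) (auto simp: indicator_def)
    fix a b :: real
    show "(\<integral>x. indicator (box a b) x * w x \<partial>lborel) = 0"
    proof (cases "a \<le> b")
      case True
      \<comment> \<open>On the line a box is an open interval; it differs from the half-open one
        only in the point \<open>b\<close>.\<close>
      have "AE x in lborel. indicator (box a b) x * w x = indicator {a<..b} x * w x"
        using AE_lborel_singleton[of b] by eventually_elim (auto simp: indicator_def)
      then have "(\<integral>x. indicator (box a b) x * w x \<partial>lborel) = (\<integral>x. indicator {a<..b} x * w x \<partial>lborel)"
        by (intro integral_cong_AE) (auto simp: w_def)
      then show ?thesis using w_eq_0[OF True] by simp
    qed simp
  qed
  then show ?thesis by eventually_elim (auto simp: w_def)
qed simp

end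

section \<open>Translations and integrability along segments\<close>

lemma integral_lborel_translate:
  fixes f :: "'a::euclidean_space \<Rightarrow> real"
  assumes [measurable]: "f \<in> borel_measurable borel"
  shows "(\<integral>x. f (x + c) \<partial>lborel) = (\<integral>x. f x \<partial>lborel)"
  by (subst lborel_distr_plus[of c, symmetric], subst integral_distr) (auto simp: add.commute)

lemma nn_integral_lborel_translate:
  fixes f :: "'a::euclidean_space \<Rightarrow> ennreal"
  assumes [measurable]: "f \<in> borel_measurable borel"
  shows "(\<integral>\<^sup>+x. f (x + c) \<partial>lborel) = (\<integral>\<^sup>+x. f x \<partial>lborel)"
  by (subst (2) lborel_distr_plus[of c, symmetric], subst nn_integral_distr) (auto simp: add.commute)

lemma integrable_lborel_translate:
  fixes f :: "'a::euclidean_space \<Rightarrow> real"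
  assumes "integrable lborel f"
  shows "integrable lborel (\<lambda>x. f (x + c))"
proof -
  have "integrable (distr lborel borel ((+) c)) f" using assms by (simp add: lborel_distr_plus)
  then show ?thesis by (subst (asm) integrable_distr_eq) (use assms in \<open>auto simp: add.commute\<close>)
qed

text \<open>With \<open>r\<close> as the outer variable, translation invariance makes the inner
  integral of the absolute value the same for all \<open>r\<close> in \<open>{0..s}\<close>, so
  Fubini applies; swapping the variables gives the stated order. The direction e = 0 is allowed and
  covers plain products of an indicator in \<open>r\<close> with \<open>H x\<close>.\<close>

lemma integrable_along_line:
  fixes H :: "'a::euclidean_space \<Rightarrow> real"
  assumes H: "integrable lborel H"
  shows "integrable (lborel \<Otimes>\<^sub>M lborel) (\<lambda>(x, r). indicator {0..s::real} r * H (x + r *\<^sub>R e))"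
proof -
  have [measurable]: "H \<in> borel_measurable borel" using H by auto
  have "integrable (lborel \<Otimes>\<^sub>M lborel) (\<lambda>(r, x). indicator {0..s} r * H (x + r *\<^sub>R e))"
  proof (rule lborel_pair.Fubini_integrable)
    show "(\<lambda>(r, x). indicator {0..s} r * H (x + r *\<^sub>R e)) \<in> borel_measurable (lborel \<Otimes>\<^sub>M lborel)"
      by measurable
    have "(\<integral>x. norm (indicator {0..s} r * H (x + r *\<^sub>R e)) \<partial>lborel) = indicator {0..s} r * (\<integral>x. \<bar>H x\<bar> \<partial>lborel)" for r
      using integral_lborel_translate[of "\<lambda>x. \<bar>H x\<bar>" "r *\<^sub>R e"] by (simp add: abs_mult)
    then show "integrable lborel (\<lambda>r. \<integral>x. norm (case (r, x) of (r, x) \<Rightarrow> indicator {0..s} r * H (x + r *\<^sub>R e)) \<partial>lborel)"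
      by (simp add: emeasure_lborel_Icc_eq)
    show "AE r in lborel. integrable lborel (\<lambda>x. case (r, x) of (r, x) \<Rightarrow> indicator {0..s} r * H (x + r *\<^sub>R e))"
      by (simp add: integrable_lborel_translate H)
  qed
  from lborel_pair.integrable_product_swap[OF this] show ?thesis by simp
qed

lemma integrable_indicator_cbox: "integrable lborel (indicator (cbox a b) :: 'a::euclidean_space \<Rightarrow> real)"
  by (simp add: emeasure_lborel_cbox_eq)

text \<open>This passes from square integrability to integrability on sets of finite
  measure.\<close>

lemma abs_le_1_plus_square: "\<bar>t :: real\<bar> \<le> 1 + t\<^sup>2"
  using zero_le_power2[of "\<bar>t\<bar> - 1"] by (simp add: power2_eq_square algebra_simps) 

lemma L2_loc_integrable_cbox:
  assumes "u \<in> L2_loc"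
  shows "integrable lborel (\<lambda>x. indicator (cbox a b) x * u x)"
proof (rule Bochner_Integration.integrable_bound)
  have [measurable]: "u \<in> borel_measurable borel" using assms by (simp add: L2_loc_def)
  show "(\<lambda>x. indicator (cbox a b) x * u x) \<in> borel_measurable lborel" by measurable
  show "integrable lborel (\<lambda>x. indicator (cbox a b) x + indicator (cbox a b) x * (u x)\<^sup>2)"
    using assms integrable_indicator_cbox[of a b]
    by (auto simp: L2_loc_def set_integrable_def)
  show "AE x in lborel. norm (indicator (cbox a b) x * u x) \<le> norm (indicator (cbox a b) x + indicator (cbox a b) x * (u x)\<^sup>2)"
    using abs_le_1_plus_square by (intro AE_I2) (auto simp: indicator_def)
qed

lemma L2_integrable_along_line:
  fixes g :: "real ^ 'n \<Rightarrow> real"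
  assumes "g \<in> L2"
  shows "integrable (lborel \<Otimes>\<^sub>M lborel) (\<lambda>(x, r). indicator (cbox a b) x * (indicator {0..s::real} r * g (x + r *\<^sub>R e)))"
proof (rule Bochner_Integration.integrable_bound)
  have [measurable]: "g \<in> borel_measurable borel" using assms by (simp add: L2_def)
  show "(\<lambda>(x, r). indicator (cbox a b) x * (indicator {0..s} r * g (x + r *\<^sub>R e))) \<in> borel_measurable (lborel \<Otimes>\<^sub>M lborel)"
    by measurable
  \<comment> \<open>The majorant is an indicator plus a square. Its first summand is the case of
    direction 0, its second one uses the integrability of the square of \<open>g\<close>.\<close>
  have "integrable (lborel \<Otimes>\<^sub>M lborel) (\<lambda>p. (case p of (x, r) \<Rightarrow> indicator {0..s} r * indicator (cbox a b) (x + r *\<^sub>R 0)) +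
      (case p of (x, r) \<Rightarrow> indicator {0..s} r * (g (x + r *\<^sub>R e))\<^sup>2))"
    using assms by (intro Bochner_Integration.integrable_add integrable_along_line integrable_indicator_cbox) (simp add: L2_def)
  then show "integrable (lborel \<Otimes>\<^sub>M lborel) (\<lambda>(x, r). indicator {0..s} r * indicator (cbox a b) x + indicator {0..s} r * (g (x + r *\<^sub>R e))\<^sup>2)"
    by (simp add: case_prod_beta')
  show "AE p in lborel \<Otimes>\<^sub>M lborel. norm (case p of (x, r) \<Rightarrow> indicator (cbox a b) x * (indicator {0..s} r * g (x + r *\<^sub>R e)))
      \<le> norm (case p of (x, r) \<Rightarrow> indicator {0..s} r * indicator (cbox a b) x + indicator {0..s} r * (g (x + r *\<^sub>R e))\<^sup>2)"
    using abs_le_1_plus_square by (intro AE_I2) (auto simp: indicator_def split: prod.split)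
qed

section \<open>Weak derivatives along lines\<close>

lemma has_derivative_bump:
  "(bump m a b has_derivative frechet_derivative (bump m a b) (at x)) (at x)"
  using C_k_bump[of "Suc 0" m a b] by (simp add: differentiable_on_def flip: frechet_derivative_works)

lemma continuous_on_bump: "continuous_on A (bump m a b)"
  using C_k_bump[of 0 m a b] continuous_on_subset by fastforce

lemma continuous_on_partial_deriv_bump: "continuous_on A (partial_deriv i (bump m a b))"
  using C_k_bump[of "Suc 0" m a b] continuous_on_subset by fastforce

lemma measurable_bump [measurable]:
  "bump m a b \<in> borel_measurable borel" "partial_deriv i (bump m a b) \<in> borel_measurable borel"
  by (intro borel_measurable_continuous_onI continuous_on_bump continuous_on_partial_deriv_bump)+

lemma has_real_derivative_bump_line:
  "((\<lambda>r. bump m a b (x - r *\<^sub>R axis i 1)) has_real_derivative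
      - partial_deriv i (bump m a b) (x - r *\<^sub>R axis i 1)) (at r)"
proof -
  let ?D = "frechet_derivative (bump m a b) (at (x - r *\<^sub>R axis i 1))"
  have "((\<lambda>r. x - r *\<^sub>R axis i 1) has_derivative (\<lambda>h. - (h *\<^sub>R axis i 1))) (at r)"
    by (auto intro!: derivative_eq_intros)
  from has_derivative_compose[OF this has_derivative_bump]
  have D: "((\<lambda>r. bump m a b (x - r *\<^sub>R axis i 1)) has_derivative (\<lambda>h. ?D (- (h *\<^sub>R axis i 1)))) (at r)" .
  have eq: "(\<lambda>h. ?D (- (h *\<^sub>R axis i 1))) = (*) (- ?D (axis i 1))"
    using has_derivative_linear[OF has_derivative_bump[of m a b "x - r *\<^sub>R axis i 1"]]
    by (auto simp: linear_neg linear_scale)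
  show ?thesis
    unfolding has_field_derivative_def partial_deriv_def using D unfolding eq .
qed

lemma partial_deriv_bump_translate:
  "partial_deriv i (bump m (a + c) (b + c)) x = partial_deriv i (bump m a b) (x - c)"
proof -
  have "((\<lambda>x. x - c) has_derivative (\<lambda>h. h)) (at x)"
    by (auto intro!: derivative_eq_intros)
  from has_derivative_compose[OF this has_derivative_bump]
  have "(bump m (a + c) (b + c) has_derivative frechet_derivative (bump m a b) (at (x - c))) (at x)"
    by (simp add: bump_translate[abs_def])
  then show ?thesis by (simp add: partial_derivI) (simp add: partial_deriv_def)
qed

text \<open>Outside the box the bump attains its minimum.\<close>

lemma partial_deriv_bump_eq_0:
  assumes "0 < m" "x \<notin> box a b"
  shows "partial_deriv i (bump m a b) x = 0"
proof -
  have "frechet_derivative (bump m a b) (at x) = (\<lambda>v. 0)"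
    by (rule differential_zero_maxmin[of x UNIV, OF _ _ has_derivative_bump])
       (simp_all add: bump_eq_0[OF assms] bump_nonneg)
  then show ?thesis by (simp add: partial_deriv_def)
qed

lemma partial_deriv_bump_bounded:
  assumes "0 < m"
  obtains M where "\<And>x. \<bar>partial_deriv i (bump m a b) x\<bar> \<le> M"
proof -
  have "compact (partial_deriv i (bump m a b) ` cbox a b)"
    by (intro compact_continuous_image continuous_on_partial_deriv_bump compact_cbox)
  then obtain M where M: "\<And>x. x \<in> cbox a b \<Longrightarrow> \<bar>partial_deriv i (bump m a b) x\<bar> \<le> M"
    using compact_imp_bounded by (force simp: bounded_iff)
  have "\<bar>partial_deriv i (bump m a b) x\<bar> \<le> \<bar>M\<bar>" for x
  proof (cases "x \<in> cbox a b")
    case True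
    then show ?thesis using M[of x] by simp
  next
    case False
    then have "x \<notin> box a b" using box_subset_cbox by blast
    then show ?thesis by (simp add: partial_deriv_bump_eq_0[OF assms])
  qed
  then show ?thesis by (rule that)
qed

lemma bump_le_indicator_cbox:
  assumes "0 < m"
  shows "bump m a b x \<le> indicator (cbox a b) x"
proof (cases "x \<in> cbox a b")
  case True
  then show ?thesis by (simp add: bump_le_1)
next
  case False
  then have "x \<notin> box a b" using box_subset_cbox by blast
  then show ?thesis by (simp add: bump_eq_0[OF assms])
qed

lemma integrable_mult_bump:
  assumes "0 < m" and [measurable]: "w \<in> borel_measurable borel"
    and w: "integrable lborel (\<lambda>x. indicator (cbox a b) x * w x)"
  shows "integrable lborel (\<lambda>x. w x * bump m a b x)"
proof (rule Bochner_Integration.integrable_bound[OF w])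
  show "AE x in lborel. norm (w x * bump m a b x) \<le> norm (indicator (cbox a b) x * w x)"
  proof (rule AE_I2)
    fix x
    have "bump m a b x \<le> indicator (cbox a b) x" by (rule bump_le_indicator_cbox[OF \<open>0 < m\<close>])
    then show "norm (w x * bump m a b x) \<le> norm (indicator (cbox a b) x * w x)"
      using bump_nonneg[of m a b x] by (simp add: abs_mult mult.commute mult_left_mono)
  qed
qed measurable

text \<open>The shift is moved from \<open>u\<close> to the bump, and the increment of the bump is
  written as an integral of its partial derivative over \<open>r\<close>. After Fubini, the weak
  derivative tested against the bump translated by r e replaces \<open>u\<close> by
  \<open>g\<close>; a second use of Fubini restores the order of integration.\<close>

lemma weak_increment_bump:
  fixes u g :: "real ^ 'n \<Rightarrow> real"
  assumes u: "u \<in> L2_loc" and g: "g \<in> L2" and weak: "has_distributional_partial u i g"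
    and "0 \<le> s" "0 < m"
  defines "e \<equiv> axis i 1"
  shows "(\<integral>x. u (x + s *\<^sub>R e) * bump m a b x \<partial>lborel) - (\<integral>x. u x * bump m a b x \<partial>lborel)
    = (\<integral>x. (\<integral>r. indicator {0..s} r * g (x + r *\<^sub>R e) \<partial>lborel) * bump m a b x \<partial>lborel)"
proof -
  have [measurable]: "u \<in> borel_measurable borel" "g \<in> borel_measurable borel"
    using u g by (simp_all add: L2_loc_def L2_def)
  let ?\<phi> = "bump m a b" and ?\<phi>' = "partial_deriv i (bump m a b)"
  have FTC: "(\<integral>r. indicator {0..s} r * - ?\<phi>' (x - r *\<^sub>R e) \<partial>lborel) = ?\<phi> (x - s *\<^sub>R e) - ?\<phi> x" for x
  proof -
    have "(\<integral>r. indicator {0..s} r *\<^sub>R - ?\<phi>' (x - r *\<^sub>R e) \<partial>lborel) = ?\<phi> (x - s *\<^sub>R e) - ?\<phi> (x - 0 *\<^sub>R e)"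
    proof (rule integral_FTC_atLeastAtMost[OF \<open>0 \<le> s\<close>])
      show "((\<lambda>r. ?\<phi> (x - r *\<^sub>R e)) has_vector_derivative - ?\<phi>' (x - r *\<^sub>R e)) (at r within {0..s})" for r
        unfolding e_def
        by (rule has_vector_derivative_at_within)
           (rule has_real_derivative_bump_line[unfolded has_real_derivative_iff_has_vector_derivative])
      have line: "continuous_on {0..s} (\<lambda>r. x - r *\<^sub>R e)" by (intro continuous_intros)
      show "continuous_on {0..s} (\<lambda>r. - ?\<phi>' (x - r *\<^sub>R e))"
        by (rule continuous_on_minus, rule continuous_on_compose2[OF continuous_on_partial_deriv_bump[of UNIV] line]) simp
    qed
    then show ?thesis by simp
  qed
  obtain M where M: "\<And>x. \<bar>?\<phi>' x\<bar> \<le> M"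
    using partial_deriv_bump_bounded[OF \<open>0 < m\<close>] by blast
  have int1: "integrable (lborel \<Otimes>\<^sub>M lborel) (\<lambda>(x, r). indicator {0..s} r * (u x * ?\<phi>' (x - r *\<^sub>R e)))"
  proof (rule Bochner_Integration.integrable_bound)
    \<comment> \<open>As \<open>e\<close> has nonnegative components, \<open>cbox a ?b\<close>
      contains the boxes translated by r e for all \<open>r\<close> in \<open>{0..s}\<close>, so one
      majorant serves every \<open>r\<close>.\<close>
    let ?b = "b + s *\<^sub>R e"
    show "integrable (lborel \<Otimes>\<^sub>M lborel)
        (\<lambda>p. M * (case p of (x, r) \<Rightarrow> indicator {0..s} r * (indicator (cbox a ?b) (x + r *\<^sub>R 0) * u (x + r *\<^sub>R 0))))"
      by (intro integrable_mult_right integrable_along_line L2_loc_integrable_cbox u)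
    show "AE p in lborel \<Otimes>\<^sub>M lborel. norm (case p of (x, r) \<Rightarrow> indicator {0..s} r * (u x * ?\<phi>' (x - r *\<^sub>R e)))
      \<le> norm (M * (case p of (x, r) \<Rightarrow> indicator {0..s} r * (indicator (cbox a ?b) (x + r *\<^sub>R 0) * u (x + r *\<^sub>R 0))))"
    proof (intro AE_I2, clarify)
      fix x r
      have "\<bar>?\<phi>' (x - r *\<^sub>R e)\<bar> \<le> \<bar>M\<bar> * indicator (cbox a ?b) x" if "r \<in> {0..s}"
      proof (cases "x - r *\<^sub>R e \<in> box a b")
        case True
        have "a $ j \<le> x $ j \<and> x $ j \<le> ?b $ j" for j
        proof -
          have "0 \<le> r * e $ j" "r * e $ j \<le> s * e $ j"
            using that by (auto simp: e_def axis_def)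
          moreover have "a $ j < x $ j - r * e $ j" "x $ j - r * e $ j < b $ j"
            using True by (auto simp: mem_box_cart)
          ultimately show ?thesis by simp
        qed
        then have "x \<in> cbox a ?b" by (simp add: mem_box_cart)
        then show ?thesis using M[of "x - r *\<^sub>R e"] by simp
      next
        case False
        then show ?thesis by (simp add: partial_deriv_bump_eq_0[OF \<open>0 < m\<close>])
      qed
      from mult_left_mono[OF this abs_ge_zero[of "u x"]]
      show "norm (indicator {0..s} r * (u x * ?\<phi>' (x - r *\<^sub>R e)))
          \<le> norm (M * (indicator {0..s} r * (indicator (cbox a ?b) (x + r *\<^sub>R 0) * u (x + r *\<^sub>R 0))))"
        by (cases "r \<in> {0..s}") (simp_all add: abs_mult mult_ac)
    qed
  qed measurable
  have int2: "integrable (lborel \<Otimes>\<^sub>M lborel) (\<lambda>(x, r). indicator {0..s} r * g (x + r *\<^sub>R e) * ?\<phi> x)"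
  proof (rule Bochner_Integration.integrable_bound[OF L2_integrable_along_line[OF g, of a b s e]])
    show "AE p in lborel \<Otimes>\<^sub>M lborel. norm (case p of (x, r) \<Rightarrow> indicator {0..s} r * g (x + r *\<^sub>R e) * ?\<phi> x)
      \<le> norm (case p of (x, r) \<Rightarrow> indicator (cbox a b) x * (indicator {0..s} r * g (x + r *\<^sub>R e)))"
    proof (intro AE_I2, clarify)
      fix x r
      have "?\<phi> x \<le> indicator (cbox a b) x" by (rule bump_le_indicator_cbox[OF \<open>0 < m\<close>])
      then show "norm (indicator {0..s} r * g (x + r *\<^sub>R e) * ?\<phi> x)
          \<le> norm (indicator (cbox a b) x * (indicator {0..s} r * g (x + r *\<^sub>R e)))"
        using bump_nonneg[of m a b x] by (simp add: abs_mult mult.commute[of _ "?\<phi> x"] mult_right_mono)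
    qed
  qed measurable
  \<comment> \<open>A translated bump is the bump of the translated box, hence again a test
    function.\<close>
  have weak_shift: "(\<integral>x. u x * ?\<phi>' (x - r *\<^sub>R e) \<partial>lborel) = - (\<integral>x. g (x + r *\<^sub>R e) * ?\<phi> x \<partial>lborel)" for r
  proof -
    have "(\<integral>x. u x * partial_deriv i (bump m (a + r *\<^sub>R e) (b + r *\<^sub>R e)) x \<partial>lborel)
        = - (\<integral>x. g x * bump m (a + r *\<^sub>R e) (b + r *\<^sub>R e) x \<partial>lborel)"
      using weak[unfolded has_distributional_partial_def, rule_format,
          OF test_function_bump[OF \<open>0 < m\<close>, of "a + r *\<^sub>R e" "b + r *\<^sub>R e"]]
      by (simp add: distribution_partial_def distribution_of_def)
    also have "(\<integral>x. g x * bump m (a + r *\<^sub>R e) (b + r *\<^sub>R e) x \<partial>lborel) = (\<integral>x. g (x + r *\<^sub>R e) * ?\<phi> x \<partial>lborel)"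
      using integral_lborel_translate[of "\<lambda>x. g x * bump m (a + r *\<^sub>R e) (b + r *\<^sub>R e) x" "r *\<^sub>R e"]
      by (simp add: bump_translate)
    finally show ?thesis by (simp add: partial_deriv_bump_translate)
  qed
  have int_u: "integrable lborel (\<lambda>x. u x * bump m a b x)" for a b
    by (intro integrable_mult_bump L2_loc_integrable_cbox u \<open>0 < m\<close>) measurable
  have "(\<integral>x. u (x + s *\<^sub>R e) * ?\<phi> x \<partial>lborel) = (\<integral>x. u x * ?\<phi> (x - s *\<^sub>R e) \<partial>lborel)"
    using integral_lborel_translate[of "\<lambda>x. u x * ?\<phi> (x - s *\<^sub>R e)" "s *\<^sub>R e"] by simp
  then have "(\<integral>x. u (x + s *\<^sub>R e) * ?\<phi> x \<partial>lborel) - (\<integral>x. u x * ?\<phi> x \<partial>lborel)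
      = (\<integral>x. u x * ?\<phi> (x - s *\<^sub>R e) - u x * ?\<phi> x \<partial>lborel)"
    using int_u[of a b] int_u[of "a + s *\<^sub>R e" "b + s *\<^sub>R e"] by (simp add: bump_translate)
  also have "\<dots> = (\<integral>x. \<integral>r. - (indicator {0..s} r * (u x * ?\<phi>' (x - r *\<^sub>R e))) \<partial>lborel \<partial>lborel)"
  proof (intro Bochner_Integration.integral_cong refl)
    fix x
    have "u x * ?\<phi> (x - s *\<^sub>R e) - u x * ?\<phi> x = (\<integral>r. u x * (indicator {0..s} r * - ?\<phi>' (x - r *\<^sub>R e)) \<partial>lborel)"
      by (simp only: integral_mult_right_zero FTC right_diff_distrib)
    then show "u x * ?\<phi> (x - s *\<^sub>R e) - u x * ?\<phi> x = (\<integral>r. - (indicator {0..s} r * (u x * ?\<phi>' (x - r *\<^sub>R e))) \<partial>lborel)"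
      by (simp add: mult_ac)
  qed
  also have "\<dots> = - (\<integral>r. \<integral>x. indicator {0..s} r * (u x * ?\<phi>' (x - r *\<^sub>R e)) \<partial>lborel \<partial>lborel)"
    by (simp only: lborel_pair.Fubini_integral[OF int1] Bochner_Integration.integral_minus)
  also have "\<dots> = (\<integral>r. \<integral>x. indicator {0..s} r * g (x + r *\<^sub>R e) * ?\<phi> x \<partial>lborel \<partial>lborel)"
    by (simp add: mult.assoc weak_shift)
  also have "\<dots> = (\<integral>x. \<integral>r. indicator {0..s} r * g (x + r *\<^sub>R e) * ?\<phi> x \<partial>lborel \<partial>lborel)"
    by (rule lborel_pair.Fubini_integral[OF int2])
  finally show ?thesis by simp
qed

text \<open>The difference \<open>w\<close> of the two sides integrates to 0 against every bump.
  Letting the bumps steepen, its integral over every box vanishes, hence so does \<open>w\<close>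
  almost everywhere. The exceptional null set may depend on \<open>s\<close>.\<close>

lemma weak_increment:
  fixes u g :: "real ^ 'n \<Rightarrow> real"
  assumes u: "u \<in> L2_loc" and g: "g \<in> L2" and weak: "has_distributional_partial u i g"
    and "0 \<le> s"
  defines "e \<equiv> axis i 1"
  shows "AE x in lborel. u (x + s *\<^sub>R e) - u x = (\<integral>r. indicator {0..s} r * g (x + r *\<^sub>R e) \<partial>lborel)"
proof -
  have [measurable]: "u \<in> borel_measurable borel" "g \<in> borel_measurable borel"
    using u g by (simp_all add: L2_loc_def L2_def)
  define P where "P x = (\<integral>r. indicator {0..s} r * g (x + r *\<^sub>R e) \<partial>lborel)" for x
  define w where "w x = u (x + s *\<^sub>R e) - u x - P x" for x
  have [measurable]: "P \<in> borel_measurable borel" unfolding P_def by measurable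
  have [measurable]: "w \<in> borel_measurable borel" unfolding w_def by measurable
  have int_u: "integrable lborel (\<lambda>x. indicator (cbox a b) x * u x)" for a b
    by (rule L2_loc_integrable_cbox[OF u])
  have int_us: "integrable lborel (\<lambda>x. indicator (cbox a b) x * u (x + s *\<^sub>R e))" for a b
  proof -
    have "indicator (cbox (a + s *\<^sub>R e) (b + s *\<^sub>R e)) (x + s *\<^sub>R e) = (indicator (cbox a b) x :: real)" for x
      by (simp add: indicator_def mem_box_cart)
    then show ?thesis
      using integrable_lborel_translate[OF int_u[of "a + s *\<^sub>R e" "b + s *\<^sub>R e"], of "s *\<^sub>R e"] by simp
  qed
  have int_P: "integrable lborel (\<lambda>x. indicator (cbox a b) x * P x)" for a b
    using lborel_pair.integrable_fst[OF L2_integrable_along_line[OF g, of a b s e]] by (simp add: P_def)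
  have int_w: "integrable lborel (\<lambda>x. indicator (cbox a b) x * w x)" for a b
    using int_u[of a b] int_us[of a b] int_P[of a b] by (simp add: w_def right_diff_distrib)
  have bump_zero: "(\<integral>x. w x * bump m a b x \<partial>lborel) = 0" if "0 < m" for m a b
    using weak_increment_bump[OF u g weak \<open>0 \<le> s\<close> \<open>0 < m\<close>, of a b, folded e_def]
      integrable_mult_bump[OF \<open>0 < m\<close> _ int_u[of a b]]
      integrable_mult_bump[OF \<open>0 < m\<close> _ int_us[of a b]]
      integrable_mult_bump[OF \<open>0 < m\<close> _ int_P[of a b]]
    by (simp add: w_def left_diff_distrib P_def[symmetric])
  have box_zero: "(\<integral>x. indicator (box a b) x * w x \<partial>lborel) = 0" for a b
  proof (rule LIMSEQ_unique)
    show "(\<lambda>m. \<integral>x. bump (real (Suc m)) a b x * w x \<partial>lborel) \<longlonglongrightarrow> (\<integral>x. indicator (box a b) x * w x \<partial>lborel)"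
    proof (rule integral_dominated_convergence)
      show "integrable lborel (\<lambda>x. \<bar>indicator (cbox a b) x * w x\<bar>)" using int_w by simp
      show "AE x in lborel. (\<lambda>m. bump (real (Suc m)) a b x * w x) \<longlonglongrightarrow> indicator (box a b) x * w x"
        by (intro AE_I2 tendsto_intros tendsto_bump)
      fix m
      show "AE x in lborel. norm (bump (real (Suc m)) a b x * w x) \<le> \<bar>indicator (cbox a b) x * w x\<bar>"
      proof (rule AE_I2)
        fix x
        have "bump (real (Suc m)) a b x \<le> indicator (cbox a b) x"
          by (rule bump_le_indicator_cbox) simp
        then show "norm (bump (real (Suc m)) a b x * w x) \<le> \<bar>indicator (cbox a b) x * w x\<bar>"
          using bump_nonneg[of "real (Suc m)" a b x] by (simp add: abs_mult mult_right_mono)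
      qed
    qed measurable
    show "(\<lambda>m. \<integral>x. bump (real (Suc m)) a b x * w x \<partial>lborel) \<longlonglongrightarrow> 0"
      using bump_zero[of "real (Suc m)" a b for m] by (simp add: mult.commute)
  qed
  \<comment> \<open>\<open>w\<close> is only known to be integrable on bounded boxes, so it is cut
    off to an exhausting sequence of boxes. The intersection of a test box with such a box is a box
    again, so \<open>box_zero\<close> still applies.\<close>
  let ?B = "\<lambda>n::nat. box (- (real n *\<^sub>R One)) (real n *\<^sub>R One) :: (real ^ 'n) set"
  have "AE x in lborel. indicator (?B n) x * w x = 0" for n
  proof (rule box_integrals_zero_imp_AE_zero)
    show "integrable lborel (\<lambda>x. indicator (?B n) x * w x)"
      by (rule Bochner_Integration.integrable_bound[OF int_w[of "- (real n *\<^sub>R One)" "real n *\<^sub>R One"]])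
         (use box_subset_cbox[of "- (real n *\<^sub>R One)" "real n *\<^sub>R One :: real ^ 'n"] in \<open>auto simp: indicator_def\<close>)
    fix a b :: "real ^ 'n"
    obtain c d where cd: "box a b \<inter> ?B n = box c d" using box_Int_box by blast
    have "indicator (box a b) x * (indicator (?B n) x * w x) = indicator (box c d) x * w x" for x
      unfolding cd[symmetric] indicator_inter_arith by (rule mult.assoc[symmetric])
    then show "(\<integral>x. indicator (box a b) x * (indicator (?B n) x * w x) \<partial>lborel) = 0"
      by (simp only: box_zero)
  qed
  then have "AE x in lborel. \<forall>n. indicator (?B n) x * w x = 0"
    unfolding AE_all_countable by blast
  then show ?thesis
  proof eventually_elim
    case (elim x)
    obtain n where "x \<in> ?B n" using UN_box_eq_UNIV by blast
    then have "w x = 0" using elim[rule_format, of n] by simp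
    then show ?case by (simp add: w_def P_def)
  qed
qed

text \<open>Along almost every unit segment in direction \<open>e\<close> the one-dimensional lemma
  applies, so almost every point of the segment avoids the bad set \<open>E\<close>. Averaging the
  translates of \<open>E\<close> over the segment then shows that \<open>E\<close> is a null
  set.\<close>

lemma AE_grad_eq_0_on_compact_null:
  fixes u g :: "real ^ 'n \<Rightarrow> real"
  assumes u: "u \<in> L2_loc" and g: "g \<in> L2" and weak: "has_distributional_partial u i g"
    and "compact K" and null: "emeasure lborel K = 0"
  shows "AE x in lborel. u x \<in> K \<longrightarrow> g x = 0"
proof -
  have [measurable]: "u \<in> borel_measurable borel" "g \<in> borel_measurable borel" "K \<in> sets borel"
    using u g \<open>compact K\<close> by (simp_all add: L2_loc_def L2_def borel_compact)
  define e :: "real ^ 'n" where "e = axis i 1"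
  define E where "E = {x. u x \<in> K \<and> g x \<noteq> 0}"
  have [measurable]: "E \<in> sets borel" unfolding E_def by measurable
  text \<open>The conditional stands for \<open>indicator {0..t} r\<close>, whose joint measurability in \<open>r\<close> and \<open>t\<close>
    is not automatic.\<close>
  define Q where "Q x t \<longleftrightarrow> t \<in> {0..1} \<longrightarrow>
      u (x + t *\<^sub>R e) - u x = (\<integral>r. (if 0 \<le> r \<and> r \<le> t then 1 else 0) * g (x + r *\<^sub>R e) \<partial>lborel)" for x and t :: real
  \<comment> \<open>For each \<open>t\<close> there is a null set of points \<open>x\<close>. Joint
    measurability of \<open>Q\<close> lets \<open>AE_commute\<close> exchange the quantifiers, so
    that one fixed line can be examined for almost every \<open>t\<close>.\<close>
  have "AE t in lborel. AE x in lborel. Q x t"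
  proof (rule AE_I2)
    fix t :: real
    show "AE x in lborel. Q x t"
      using weak_increment[OF u g weak, of t] by (cases "0 \<le> t") (auto simp: Q_def e_def indicator_def of_bool_def)
  qed
  moreover have "{p \<in> space (lborel \<Otimes>\<^sub>M lborel). Q (fst p) (snd p)} \<in> sets (lborel \<Otimes>\<^sub>M lborel)"
  proof -
    have [measurable]: "(\<lambda>p. \<integral>r. (if 0 \<le> r \<and> r \<le> snd p then 1 else 0) * g (fst p + r *\<^sub>R e) \<partial>lborel)
        \<in> borel_measurable (lborel \<Otimes>\<^sub>M lborel)"
      by measurable
    show ?thesis unfolding Q_def by measurable
  qed
  ultimately have Q: "AE x in lborel. AE t in lborel. Q x t"
    using lborel_pair.AE_commute[THEN iffD2] by blast
  have "AE x in lborel. integrable lborel (\<lambda>r. indicator {0..1::real} r * (g (x + r *\<^sub>R e))\<^sup>2)"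
    using lborel_pair.AE_integrable_fst[OF integrable_along_line[of "\<lambda>x. (g x)\<^sup>2" 1 e]] g by (simp add: L2_def)
  then have lines: "AE x in lborel. AE t in lborel. t \<in> {0..1::real} \<longrightarrow> x + t *\<^sub>R e \<notin> E"
    using Q
  proof eventually_elim
    case (elim x)
    \<comment> \<open>Cutting off to the unit segment makes \<open>G\<close> integrable on the whole
      line. With base value \<open>u x\<close>, \<open>V\<close> then agrees with \<open>u\<close>
      along the segment for almost every \<open>t\<close>.\<close>
    define G where "G r = indicator {0..1} r * g (x + r *\<^sub>R e)" for r
    define V where "V t = u x + (\<integral>r. indicator {..t} r * G r \<partial>lborel)" for t
    have [measurable]: "G \<in> borel_measurable borel"
      unfolding G_def[abs_def] by measurable
    interpret indefinite_integral G V "u x"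
    proof
      show "integrable lborel G"
      proof (rule Bochner_Integration.integrable_bound)
        show "integrable lborel (\<lambda>r. indicator {0..1} r + indicator {0..1::real} r * (g (x + r *\<^sub>R e))\<^sup>2)"
          using elim(1) by (simp add: emeasure_lborel_Icc_eq)
        show "AE r in lborel. norm (G r) \<le> norm (indicator {0..1} r + indicator {0..1::real} r * (g (x + r *\<^sub>R e))\<^sup>2)"
          using abs_le_1_plus_square by (intro AE_I2) (auto simp: G_def indicator_def)
      qed simp
    qed (simp add: V_def)
    show ?case
      using elim(2) AE_eq_0_on_compact_null[OF \<open>compact K\<close> null]
    proof eventually_elim
      case (elim t)
      have "u (x + t *\<^sub>R e) = V t" if "t \<in> {0..1}"
      proof -
        have "indicator {..t} r * G r = (if 0 \<le> r \<and> r \<le> t then 1 else 0) * g (x + r *\<^sub>R e)" for r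
          using that by (auto simp: G_def indicator_def)
        then show ?thesis using elim(1) that by (simp add: Q_def V_def)
      qed
      then show ?case using elim(2) by (auto simp: E_def G_def)
    qed
  qed
  \<comment> \<open>The segment has length 1 and translates of \<open>E\<close> have equal measure,
    so the measure of \<open>E\<close> is a double integral; in the other order its inner integral
    vanishes by \<open>lines\<close>.\<close>
  have "emeasure lborel E = (\<integral>\<^sup>+t. indicator {0..1::real} t * emeasure lborel E \<partial>lborel)"
    by (simp add: nn_integral_multc)
  also have "\<dots> = (\<integral>\<^sup>+t. \<integral>\<^sup>+x. indicator {0..1::real} t * indicator E (x + t *\<^sub>R e) \<partial>lborel \<partial>lborel)"
    by (simp add: nn_integral_cmult nn_integral_lborel_translate)
  also have "\<dots> = (\<integral>\<^sup>+x. \<integral>\<^sup>+t. indicator {0..1::real} t * indicator E (x + t *\<^sub>R e) \<partial>lborel \<partial>lborel)"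
    by (rule lborel_pair.Fubini') measurable
  also have "\<dots> = 0"
  proof (subst nn_integral_0_iff_AE)
    show "AE x in lborel. (\<integral>\<^sup>+t. indicator {0..1::real} t * indicator E (x + t *\<^sub>R e) \<partial>lborel) = 0"
      using lines
    proof eventually_elim
      case (elim x)
      then show ?case
        by (subst nn_integral_0_iff_AE) (auto simp: indicator_def elim: eventually_mono)
    qed
  qed measurable
  finally have "E \<in> null_sets lborel" by (auto intro: null_setsI)
  from AE_not_in[OF this] show ?thesis by eventually_elim (simp add: E_def)
qed

section \<open>Absolute continuity of the image measure\<close>

theorem proposition1:
  fixes u :: "real ^ 'n \<Rightarrow> real"
    and grad_u :: "'n \<Rightarrow> real ^ 'n \<Rightarrow> real"
  assumes "u \<in> L2_loc"
    and "\<And>i. has_distributional_partial u i (grad_u i)"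
    and "\<And>i. grad_u i \<in> L2"
  shows "absolutely_continuous lborel
           (distr (density lborel (\<lambda>x. ennreal (\<Sum>i\<in>UNIV. (grad_u i x)\<^sup>2))) borel u)"
    (is "absolutely_continuous lborel ?\<nu>")
proof -
  let ?h = "\<lambda>x. \<Sum>i\<in>UNIV. (grad_u i x)\<^sup>2"
  have [measurable]: "u \<in> borel_measurable borel" "grad_u i \<in> borel_measurable borel" for i
    using assms(1,3) by (simp_all add: L2_loc_def L2_def)
  have emeasure_\<nu>: "emeasure ?\<nu> A = (\<integral>\<^sup>+x. ennreal (?h x) * indicator A (u x) \<partial>lborel)"
    if [measurable]: "A \<in> sets borel" for A
  proof -
    have "emeasure ?\<nu> A = (\<integral>\<^sup>+y. indicator A y \<partial>?\<nu>)" by simp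
    also have "\<dots> = (\<integral>\<^sup>+x. ennreal (?h x) * indicator A (u x) \<partial>lborel)"
      by (subst nn_integral_distr) (simp_all add: nn_integral_density)
    finally show ?thesis .
  qed
  have compact: "emeasure ?\<nu> K = 0" if "compact K" "emeasure lborel K = 0" for K
  proof -
    have [measurable]: "K \<in> sets borel" using \<open>compact K\<close> by (rule borel_compact)
    \<comment> \<open>There are finitely many directions, so one null set of \<open>x\<close> serves
      all \<open>i\<close>.\<close>
    have "AE x in lborel. \<forall>i. u x \<in> K \<longrightarrow> grad_u i x = 0"
      unfolding AE_all_countable using AE_grad_eq_0_on_compact_null[OF assms(1,3,2) that] by blast
    then have "AE x in lborel. ennreal (?h x) * indicator K (u x) = 0"
      by eventually_elim (auto simp: indicator_def)
    then show ?thesis by (simp add: emeasure_\<nu> nn_integral_0_iff_AE)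
  qed
  have finite: "emeasure ?\<nu> (space ?\<nu>) \<noteq> \<infinity>"
  proof -
    have "integrable lborel ?h" using assms(3) by (simp add: L2_def)
    then have "(\<integral>\<^sup>+x. ennreal (?h x) \<partial>lborel) < \<infinity>"
      by (simp add: nn_integral_eq_integral sum_nonneg)
    then show ?thesis by (simp add: emeasure_\<nu>)
  qed
  show ?thesis
    unfolding absolutely_continuous_def
  proof
    fix N :: "real set"
    assume N: "N \<in> null_sets lborel"
    \<comment> \<open>Finiteness of the image measure permits approximation from inside by compact
      subsets of \<open>N\<close>, and these are null sets themselves.\<close>
    have "emeasure ?\<nu> N = (SUP K\<in>{K. K \<subseteq> N \<and> compact K}. emeasure ?\<nu> K)"
      using N by (intro inner_regular finite) auto
    also have "\<dots> = 0"
    proof -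
      have "emeasure lborel K = 0" if "K \<subseteq> N" for K
        using N that by (metis emeasure_eq_0 null_setsD1 null_setsD2)
      then show ?thesis by (auto simp: compact SUP_eq_iff intro!: SUP_eq_const)
    qed
    finally show "N \<in> null_sets ?\<nu>" using N by (auto simp: null_sets_def)
  qed
qed

end
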